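(* Let $L$ be a bounded chain and let $n\geqslant 1$. A function $f\colon L^{n}\rightarrow L$ is a polynomial function if and only if it is nondecreasing, strongly idempotent, and has a componentwise convex range.
   Context: A bounded chain is a totally ordered set $L$ with least element $0$ and greatest element $1$, viewed as a lattice with $\wedge=\min$, $\vee=\max$. $L^n$ has the componentwise order and operations. A polynomial function $L^n\to L$ is any function obtained by finitely many applications of: (i) for each $i\in\{1,\ldots,n\}$ and $c\in L$, the projection $\mathbf{x}\mapsto x_i$ and the constant function $\mathbf{x}\mapsto c$ are polynomial functions; (ii) if $f,g$ are polynomial functions then so are $f\vee g$ and $f\wedge g$ (pointwise). $f$ is nondecreasing if $\mathbf{a}\leqslant\mathbf{b}$ implies $f(\mathbf{a})\leqslant f(\mathbf{b})$. $f$ is strongly idempotent if $f(x_1,\ldots,x_{k-1},f(\mathbf{x}),x_{k+1},\ldots,x_n)=f(\mathbf{x})$ for every $\mathbf{x}\in L^n$ and every $k\in\{1,\ldots,n\}$. $S\subseteq L$ is convex if $a,b\in S$, $c\in L$, $a\leqslant c\leqslant b$ imply $c\in S$. $f$ has a componentwise convex range if either $n=1$ and the range of $f$ is convex, or $n>1$ and for every $\mathbf{a}\in L^n$ and every $k\in\{1,\ldots,n\}$ the unary function $L\to L$, $x\mapsto f(a_1,\ldots,a_{k-1},x,a_{k+1},\ldots,a_n)$, has a convex range. *)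

theory Defs
  imports "HOL-Library.Cardinality"
begin

text \<open>
  A bounded chain is a type of sort \<open>{linorder, order_bot, order_top}\<close>. The power \<open>L\<^sup>n\<close> is
  the function type \<open>'n \<Rightarrow> 'a\<close> with \<open>'n\<close> finite and \<open>n = CARD('n)\<close>, so \<open>n \<ge> 1\<close> holds because
  types are nonempty; the library order on functions is the componentwise one.
\<close>

inductive polynomial_function :: "(('n::finite \<Rightarrow> 'a::linorder) \<Rightarrow> 'a) \<Rightarrow> bool" where
  proj: "polynomial_function (\<lambda>x. x i)"
| const: "polynomial_function (\<lambda>x. c)"
| join: "polynomial_function f \<Longrightarrow> polynomial_function g \<Longrightarrow>
    polynomial_function (\<lambda>x. max (f x) (g x))"
| meet: "polynomial_function f \<Longrightarrow> polynomial_function g \<Longrightarrow>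
    polynomial_function (\<lambda>x. min (f x) (g x))"

definition strongly_idempotent :: "(('n::finite \<Rightarrow> 'a) \<Rightarrow> 'a) \<Rightarrow> bool" where
  "strongly_idempotent f \<longleftrightarrow> (\<forall>x k. f (x(k := f x)) = f x)"

definition order_convex :: "'a::linorder set \<Rightarrow> bool" where
  "order_convex S \<longleftrightarrow> (\<forall>a b c. a \<in> S \<and> b \<in> S \<and> a \<le> c \<and> c \<le> b \<longrightarrow> c \<in> S)"

definition componentwise_convex_range :: "(('n::finite \<Rightarrow> 'a::linorder) \<Rightarrow> 'a) \<Rightarrow> bool" where
  "componentwise_convex_range f \<longleftrightarrow>
    CARD('n) = 1 \<and> order_convex (range f) \<or>
    CARD('n) > 1 \<and> (\<forall>a k. order_convex (range (\<lambda>x. f (a(k := x)))))"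

end

theory Submission
  imports Defs
begin

text \<open>
  Both properties are equivalent to a third one: \<open>f\<close> is monotone and each of its unary sections
  \<open>x \<mapsto> f (a(k := x))\<close> is the truncation of \<open>x\<close> to the interval between the values of the section
  at \<open>\<bottom>\<close> and at \<open>\<top>\<close>.

  For polynomial functions this follows by induction on their construction: by distributivity, the
  lattice operations act separately on the two ends of the interval. Conversely, expanding one
  coordinate after another by means of the truncation identity replaces the variables of \<open>f\<close>
  by constants and ends in a lattice polynomial.

  Truncations of a chain are, on the other hand, exactly the monotone idempotent self-maps with
  convex range: such a map fixes its range pointwise, the range is the whole interval between the
  values at \<open>\<bottom>\<close> and \<open>\<top>\<close>, and monotonicity settles the points outside that interval. Strong
  idempotency of \<open>f\<close> says precisely that all of its sections are idempotent, and a componentwise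
  convex range says that all of their ranges are convex.
\<close>

definition median_decomposable ::
    "(('n \<Rightarrow> 'a::{linorder, order_bot, order_top}) \<Rightarrow> 'a) \<Rightarrow> bool" where
  "median_decomposable f \<longleftrightarrow>
    (\<forall>a k. f a = max (f (a(k := bot))) (min (a k) (f (a(k := top)))))"

lemma mono_fun_upd:
  fixes f :: "('n \<Rightarrow> 'a::order) \<Rightarrow> 'b::order"
  assumes "mono f"
  shows "mono (\<lambda>x. f (a(k := x)))"
  using assms by (auto simp: mono_def le_fun_def)

text \<open>
  In dimension one the range of \<open>f\<close> is the range of its only section, which makes the case
  distinction on the dimension disappear.
\<close>

lemma componentwise_convex_range_iff:
  fixes f :: "('n::finite \<Rightarrow> 'a::linorder) \<Rightarrow> 'a"
  shows "componentwise_convex_range f \<longleftrightarrow> (\<forall>a k. order_convex (range (\<lambda>x. f (a(k := x)))))"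
proof (cases "CARD('n) = 1")
  case True
  have "range (\<lambda>x. f (a(k := x))) = range f" for a k
  proof -
    obtain j :: 'n where "UNIV = {j}"
      using True by (auto simp: card_1_singleton_iff)
    then have single: "i = k" for i :: 'n
      by (metis UNIV_I singletonD)
    then have "b = a(k := b k)" for b
      by (metis ext fun_upd_same)
    then show ?thesis
      by (metis (no_types, lifting) image_subset_iff rangeI subset_antisym)
  qed
  with True show ?thesis
    by (simp add: componentwise_convex_range_def)
next
  case False
  moreover have "CARD('n) > 0"
    by simp
  ultimately have "CARD('n) > 1"
    by linarith
  with False show ?thesis
    by (simp add: componentwise_convex_range_def)
qed

lemma mono_idempotent_convex_eq_truncation:
  fixes h :: "'a::{linorder, order_bot, order_top} \<Rightarrow> 'a"
  assumes "mono h" and idem: "\<And>x. h (h x) = h x" and convex: "order_convex (range h)"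
  shows "h x = max (h bot) (min x (h top))"
proof -
  have le: "h y \<le> h z" if "y \<le> z" for y z
    using \<open>mono h\<close> that by (rule monoD)
  have bounds: "h bot \<le> h x" "h x \<le> h top"
    by (simp_all add: le)
  consider "x < h bot" | "h top < x" | "h bot \<le> x" "x \<le> h top"
    by fastforce
  then show ?thesis
  proof cases
    case 1
    then have "h x \<le> h bot"
      using le[of x "h bot"] idem by simp
    with 1 bounds show ?thesis
      by (metis order.antisym less_imp_le max.absorb1 min.coboundedI1)
  next
    case 2
    then have "h top \<le> h x"
      using le[of "h top" x] idem by simp
    with 2 bounds show ?thesis
      by (metis order.antisym less_imp_le max.absorb2 min.absorb2 order.trans)
  next
    case 3
    \<comment> \<open>The convex range contains both bounds of \<open>x\<close>, and an idempotent map fixes its range.\<close>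
    then have "x \<in> range h"
      using convex unfolding order_convex_def by blast
    then have "h x = x"
      using idem by auto
    with 3 show ?thesis by (simp add: max_def min_def)
  qed
qed

lemma truncation_idempotent:
  fixes p q x :: "'a::linorder"
  shows "max p (min (max p (min x q)) q) = max p (min x q)"
  by (auto simp: max_def min_def)

lemma order_convex_range_truncation:
  fixes p q :: "'a::linorder"
  shows "order_convex (range (\<lambda>x. max p (min x q)))"
proof -
  \<comment> \<open>For \<open>q < p\<close> the map is constantly \<open>p\<close>.\<close>
  have "range (\<lambda>x. max p (min x q)) = {p..max p q}"
  proof
    show "range (\<lambda>x. max p (min x q)) \<subseteq> {p..max p q}"
      by (auto simp: max_def min_def)
    show "{p..max p q} \<subseteq> range (\<lambda>x. max p (min x q))"
    proof
      fix y assume "y \<in> {p..max p q}"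
      then have "y = max p (min y q)" by (auto simp: max_def min_def split: if_splits)
      then show "y \<in> range (\<lambda>x. max p (min x q))" by blast
    qed
  qed
  then show ?thesis
    by (auto simp: order_convex_def)
qed

lemma median_decomposable_section:
  assumes "median_decomposable f"
  shows "f (a(k := x)) = max (f (a(k := bot))) (min x (f (a(k := top))))"
  using assms unfolding median_decomposable_def by (metis fun_upd_same fun_upd_upd)

lemma median_decomposable_imp_strongly_idempotent_convex:
  fixes f :: "('n::finite \<Rightarrow> 'a::{linorder, order_bot, order_top}) \<Rightarrow> 'a"
  assumes f: "median_decomposable f"
  shows "strongly_idempotent f \<and> componentwise_convex_range f"
proof -
  have "f (a(k := f a)) = f a" for a k
  proof -
    let ?p = "f (a(k := bot))" and ?q = "f (a(k := top))"
    have trunc: "f a = max ?p (min (a k) ?q)"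
      using f unfolding median_decomposable_def by blast
    have "f (a(k := f a)) = max ?p (min (f a) ?q)"
      by (rule median_decomposable_section[OF f])
    also have "\<dots> = f a"
      using truncation_idempotent trunc by metis
    finally show ?thesis .
  qed
  moreover have "order_convex (range (\<lambda>x. f (a(k := x))))" for a k
    by (subst median_decomposable_section[OF f]) (rule order_convex_range_truncation)
  ultimately show ?thesis
    by (simp add: strongly_idempotent_def componentwise_convex_range_iff)
qed

lemma strongly_idempotent_convex_imp_median_decomposable:
  fixes f :: "('n::finite \<Rightarrow> 'a::{linorder, order_bot, order_top}) \<Rightarrow> 'a"
  assumes "mono f" "strongly_idempotent f" "componentwise_convex_range f"
  shows "median_decomposable f"
  unfolding median_decomposable_def
proof (intro allI)
  fix a k
  let ?h = "\<lambda>x. f (a(k := x))"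
  have "?h (?h x) = ?h x" for x
  proof -
    have "f ((a(k := x))(k := f (a(k := x)))) = f (a(k := x))"
      using assms(2) unfolding strongly_idempotent_def by blast
    then show ?thesis by simp
  qed
  moreover have "order_convex (range ?h)"
    using assms(3) by (simp add: componentwise_convex_range_iff)
  ultimately have "?h (a k) = max (?h bot) (min (a k) (?h top))"
    by (intro mono_idempotent_convex_eq_truncation mono_fun_upd[OF assms(1)])
  then show "f a = max (f (a(k := bot))) (min (a k) (f (a(k := top))))"
    by simp
qed

lemma polynomial_function_mono:
  "polynomial_function f \<Longrightarrow> mono f"
  by (induction rule: polynomial_function.induct)
    (auto intro!: monoI max.mono min.mono dest: monoD le_funD)

lemma max_truncations:
  fixes p q p' q' x :: "'a::linorder"
  shows "max (max p (min x q)) (max p' (min x q')) = max (max p p') (min x (max q q'))"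
  by (auto simp: max_def min_def)

text \<open>
  Distributing the left-hand side also produces the mixed terms \<open>min p (min x q')\<close> and
  \<open>min p' (min x q)\<close>; these are absorbed by \<open>min x (min q q')\<close> because the intervals are nonempty.
\<close>

lemma min_truncations:
  fixes p q p' q' x :: "'a::linorder"
  assumes "p \<le> q" "p' \<le> q'"
  shows "min (max p (min x q)) (max p' (min x q')) = max (min p p') (min x (min q q'))"
  using assms by (auto simp: max_def min_def)

lemma polynomial_function_median_decomposable:
  fixes f :: "('n::finite \<Rightarrow> 'a::{linorder, order_bot, order_top}) \<Rightarrow> 'a"
  assumes "polynomial_function f"
  shows "median_decomposable f"
  using assms
proof (induction rule: polynomial_function.induct)
  case (proj i)
  show ?case
    by (simp add: median_decomposable_def)
next
  case (const c)
  show ?case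
    by (simp add: median_decomposable_def)
next
  case (join f g)
  show ?case
    unfolding median_decomposable_def
  proof (intro allI)
    fix a k
    have "f a = max (f (a(k := bot))) (min (a k) (f (a(k := top))))"
      and "g a = max (g (a(k := bot))) (min (a k) (g (a(k := top))))"
      using join.IH unfolding median_decomposable_def by blast+
    then show "max (f a) (g a) = max (max (f (a(k := bot))) (g (a(k := bot))))
        (min (a k) (max (f (a(k := top))) (g (a(k := top)))))"
      by (metis max_truncations)
  qed
next
  case (meet f g)
  show ?case
    unfolding median_decomposable_def
  proof (intro allI)
    fix a k
    have "f a = max (f (a(k := bot))) (min (a k) (f (a(k := top))))"
      and "g a = max (g (a(k := bot))) (min (a k) (g (a(k := top))))"
      using meet.IH unfolding median_decomposable_def by blast+
    moreover have "f (a(k := bot)) \<le> f (a(k := top))" "g (a(k := bot)) \<le> g (a(k := top))"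
      using meet.hyps[THEN polynomial_function_mono, THEN mono_fun_upd, THEN monoD, of bot top]
      by simp_all
    ultimately show "min (f a) (g a) = max (min (f (a(k := bot))) (g (a(k := bot))))
        (min (a k) (min (f (a(k := top))) (g (a(k := top)))))"
      by (metis min_truncations)
  qed
qed

text \<open>
  Expanding one coordinate fixes it to \<open>\<bottom>\<close> or \<open>\<top>\<close> in the two resulting terms, so the induction has
  to range over functions in which only the coordinates in \<open>K\<close> vary and the others are fixed to the
  entries of an arbitrary \<open>b\<close>.
\<close>

lemma median_decomposable_override_on_polynomial:
  fixes f :: "('n::finite \<Rightarrow> 'a::{linorder, order_bot, order_top}) \<Rightarrow> 'a"
  assumes "median_decomposable f" and "finite K"
  shows "polynomial_function (\<lambda>x. f (override_on b x K))"
  using \<open>finite K\<close>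
proof (induction K arbitrary: b)
  case empty
  show ?case
    by (simp add: polynomial_function.const)
next
  case (insert k K)
  have upd: "override_on (b(k := c)) x K = (override_on b x K)(k := c)" for c x
    using insert.hyps by (auto simp: override_on_def)
  have "f (override_on b x (insert k K)) = max (f (override_on (b(k := bot)) x K))
      (min (x k) (f (override_on (b(k := top)) x K)))" for x
    unfolding upd override_on_insert by (rule median_decomposable_section[OF assms(1)])
  then show ?case
    by (simp add: insert.IH polynomial_function.intros)
qed

lemma median_decomposable_polynomial_function:
  fixes f :: "('n::finite \<Rightarrow> 'a::{linorder, order_bot, order_top}) \<Rightarrow> 'a"
  assumes "median_decomposable f"
  shows "polynomial_function f"
proof -
  have "override_on b x UNIV = x" for b x :: "'n \<Rightarrow> 'a"
    by (simp add: override_on_def)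
  then show ?thesis
    using median_decomposable_override_on_polynomial[OF assms, of UNIV] by simp
qed

theorem theorem19:
  fixes f :: "('n::finite \<Rightarrow> 'a::{linorder, order_bot, order_top}) \<Rightarrow> 'a"
  shows "polynomial_function f \<longleftrightarrow>
    mono f \<and> strongly_idempotent f \<and> componentwise_convex_range f"
  using polynomial_function_mono polynomial_function_median_decomposable
    median_decomposable_polynomial_function median_decomposable_imp_strongly_idempotent_convex
    strongly_idempotent_convex_imp_median_decomposable
  by metis

end
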